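(* Let $G=\{-1,0,1\}$ and let $\nu$ be the Haar probability measure on $G^{\mathbb N}$. For each integer $\ell\ge1$ let $\sigma_\ell:G^{\mathbb N}\to G^{\mathbb N}$ be defined by $(\sigma_\ell\omega)(n)=\omega(\ell n)$. For every $\ell\ge 2$, the transformation $\sigma_\ell$ preserves the measure $\nu$; it is noninvertible, exact, strongly mixing, ergodic, and has infinite Kolmogorov–Sinai entropy, $h_\nu(\sigma_\ell)=+\infty$. Consequently, the full action $(\sigma_\ell)_{\ell\in\mathbb N_+}$ of the multiplicative semigroup $\mathbb N_+$ on $(G^{\mathbb N},\nu)$ is ergodic.
   Context: $\mathbb N=\mathbb N_+=\{1,2,3,\dots\}$. $G=\{-1,0,1\}$ is identified with $\mathbb Z/3\mathbb Z$, and $\nu$ is the product of the uniform probability measures on $G$, defined on the Borel sigma-algebra $\mathcal B$ of $G^{\mathbb N}$ (product topology). The maps satisfy $\sigma_\ell\circ\sigma_m=\sigma_{\ell m}$, so they form a commutative semigroup action of $(\mathbb N_+,\cdot)$. A measure-preserving map $T$ is exact if every set in $\bigcap_{k\ge1}T^{-k}\mathcal B$ has measure $0$ or $1$; strongly mixing if $\nu(A\cap T^{-k}B)\to\nu(A)\nu(B)$ as $k\to\infty$ for all measurable $A,B$. The semigroup action is ergodic if every measurable set invariant under all the $\sigma_\ell$ has measure $0$ or $1$. *)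

theory Defs
  imports "HOL-Probability.Probability"
begin

section \<open>The probability space $G^{\mathbb N}$\<close>

definition G :: "int set" where
  "G = {-1, 0, 1}"

text \<open>Addition of $G$ under its identification with $\mathbb Z/3\mathbb Z$: the representative of
  \<open>a + b\<close> modulo 3 that lies in \<open>{-1, 0, 1}\<close>.\<close>

definition G_add :: "int \<Rightarrow> int \<Rightarrow> int" where
  "G_add a b = (a + b + 1) mod 3 - 1"

definition Npos :: "nat set" where
  "Npos = {1..}"

text \<open>Points of $G^{\mathbb N}$ are functions in \<open>Npos \<rightarrow>\<^sub>E G\<close>, hence \<open>undefined\<close> at \<open>0\<close>.
  The lemmas \<open>sets_nu_eq_borel\<close> and \<open>nu_translation_invariant\<close> below show that this product measure lives
  on the Borel sets of the product topology and is the Haar measure.\<close>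

definition nu :: "(nat \<Rightarrow> int) measure" where
  "nu = (\<Pi>\<^sub>M n\<in>Npos. uniform_count_measure G)"

lemma space_nu: "space nu = Npos \<rightarrow>\<^sub>E G"
  by (simp add: nu_def space_PiM space_uniform_count_measure)

lemma prob_space_G: "prob_space (uniform_count_measure G)"
  by (intro prob_space_uniform_count_measure) (auto simp: G_def)

lemma prob_space_nu: "prob_space nu"
  unfolding nu_def by (intro prob_space_PiM prob_space_G)

lemma sets_nu_eq_borel:
  "sets nu = sigma_sets (Npos \<rightarrow>\<^sub>E G)
     {U. openin (product_topology (\<lambda>_. discrete_topology G) Npos) U}"
proof
  have 1: "{f \<in> Npos \<rightarrow>\<^sub>E G. f i \<in> A} \<in>
      {U. openin (product_topology (\<lambda>_. discrete_topology G) Npos) U}"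
    if "i \<in> Npos" "A \<subseteq> G" for i A
  proof -
    have "openin (product_topology (\<lambda>_. discrete_topology G) Npos)
        {f \<in> topspace (product_topology (\<lambda>_. discrete_topology G) Npos). f i \<in> A}"
      by (rule openin_continuous_map_preimage[OF continuous_map_product_projection])
         (use that in auto)
    then show ?thesis by simp
  qed
  show "sets nu \<subseteq> sigma_sets (Npos \<rightarrow>\<^sub>E G)
     {U. openin (product_topology (\<lambda>_. discrete_topology G) Npos) U}"
    unfolding nu_def sets_PiM_single space_uniform_count_measure sets_uniform_count_measure
    by (rule sigma_sets_mono') (use 1 in auto)
next
  define cyl where "cyl = (\<lambda>xs. {f \<in> space nu. \<forall>i<length xs. f (Suc i) = xs ! i})"
  have cyl_sets: "cyl xs \<in> sets nu" for xs :: "int list"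
  proof -
    have eq: "cyl xs = {f \<in> space nu. \<forall>i\<in>{..<length xs}. f (Suc i) \<in> {xs ! i} \<inter> G}"
      unfolding cyl_def by (auto simp: space_nu Npos_def PiE_iff)
    have "{f \<in> space nu. f (Suc i) \<in> {xs ! i} \<inter> G} \<in> sets nu" for i
      unfolding nu_def
      by (rule sets_Collect_single'[where P = "\<lambda>y. y \<in> {xs ! i} \<inter> G"])
         (auto simp: Npos_def sets_uniform_count_measure space_uniform_count_measure)
    then show ?thesis
      unfolding eq by (intro sets.sets_Collect_finite_All) simp_all
  qed
  have op: "U \<in> sets nu"
    if U: "openin (product_topology (\<lambda>_. discrete_topology G) Npos) U" for U
  proof -
    have sub: "U \<subseteq> space nu"
      using openin_subset[OF U] by (simp add: space_nu)
    have "\<exists>xs. x \<in> cyl xs \<and> cyl xs \<subseteq> U" if x: "x \<in> U" for x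
    proof -
      obtain V where V: "finite {i \<in> Npos. V i \<noteq> G}" "x \<in> Pi\<^sub>E Npos V" "Pi\<^sub>E Npos V \<subseteq> U"
        using U x unfolding openin_product_topology_alt topspace_discrete_topology by blast
      obtain n where n: "\<forall>i\<in>{i \<in> Npos. V i \<noteq> G}. i \<le> n"
        using V(1) unfolding finite_nat_set_iff_bounded_le by (elim exE)
      define xs where "xs = map (\<lambda>i. x (Suc i)) [0..<n]"
      have "x \<in> cyl xs"
        using x sub by (auto simp: cyl_def xs_def)
      moreover have "cyl xs \<subseteq> Pi\<^sub>E Npos V"
      proof
        fix f assume f: "f \<in> cyl xs"
        have fG: "f \<in> Npos \<rightarrow>\<^sub>E G" using f by (simp add: cyl_def space_nu)
        have "f i \<in> V i" if i: "i \<in> Npos" for i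
        proof (cases "V i = G")
          case True
          then show ?thesis using fG i by auto
        next
          case False
          then have "i \<le> n" using n i by blast
          then obtain j where j: "i = Suc j" "j < n"
            using i by (cases i) (auto simp: Npos_def)
          then have "f i = x i" using f by (auto simp: cyl_def xs_def)
          then show ?thesis using V(2) i by auto
        qed
        then show "f \<in> Pi\<^sub>E Npos V" using fG by (auto simp: PiE_iff)
      qed
      ultimately show ?thesis using V(3) by blast
    qed
    moreover have "cyl xs \<subseteq> U" if "xs \<in> {xs. cyl xs \<subseteq> U}" for xs using that by simp
    ultimately have "U = (\<Union>xs\<in>{xs. cyl xs \<subseteq> U}. cyl xs)" by blast
    also have "\<dots> \<in> sets nu"
      by (intro sets.countable_UN'') (simp_all add: cyl_sets)
    finally show ?thesis .
  qed
  show "sigma_sets (Npos \<rightarrow>\<^sub>E G)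
     {U. openin (product_topology (\<lambda>_. discrete_topology G) Npos) U} \<subseteq> sets nu"
    unfolding space_nu[symmetric] by (rule sets.sigma_sets_subset) (use op in auto)
qed

lemma G_add_preimage_card:
  assumes "a \<in> G" "A \<subseteq> G"
  shows "card {b \<in> G. G_add a b \<in> A} = card A"
proof -
  have bij: "bij_betw (G_add a) G G"
    using assms(1) by (auto simp: bij_betw_def inj_on_def G_def G_add_def)
  have "bij_betw (G_add a) {b \<in> G. G_add a b \<in> A} A"
    using bij assms(2) by (auto simp: bij_betw_def inj_on_def)
  then show ?thesis by (rule bij_betw_same_card)
qed

lemma nu_translation_invariant:
  assumes a: "a \<in> Npos \<rightarrow>\<^sub>E G"
  shows "distr nu nu (\<lambda>\<omega>. \<lambda>n\<in>Npos. G_add (a n) (\<omega> n)) = nu"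
proof -
  let ?U = "\<lambda>n::nat. uniform_count_measure G"
  interpret U: product_prob_space ?U Npos
    by (intro product_prob_spaceI prob_space_G)
  let ?t = "\<lambda>\<omega>. \<lambda>n\<in>Npos. G_add (a n) (\<omega> n)"
  have G_add_G: "G_add x y \<in> G" if "x \<in> G" "y \<in> G" for x y
    using that by (auto simp: G_def G_add_def)
  have meas: "?t \<in> measurable nu nu"
    unfolding nu_def
  proof (rule measurable_restrict)
    fix n assume n: "n \<in> Npos"
    have "G_add (a n) \<in> measurable (?U n) (?U n)"
      using a n G_add_G by (auto simp: measurable_def space_uniform_count_measure
          sets_uniform_count_measure)
    from measurable_compose[OF measurable_component_singleton[OF n] this]
    show "(\<lambda>\<omega>. G_add (a n) (\<omega> n)) \<in> measurable (Pi\<^sub>M Npos ?U) (?U n)" .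
  qed
  have "distr nu nu ?t = Pi\<^sub>M Npos ?U"
  proof (rule U.PiM_eq)
    show "sets (distr nu nu ?t) = sets (Pi\<^sub>M Npos ?U)" by (simp add: nu_def)
  next
    fix J :: "nat set" and F :: "nat \<Rightarrow> int set"
    assume J: "finite J" "J \<subseteq> Npos" and F: "\<And>j. j \<in> J \<Longrightarrow> F j \<in> sets (?U j)"
    have FG: "F j \<subseteq> G" if "j \<in> J" for j
      using F[OF that] by (simp add: sets_uniform_count_measure)
    let ?E = "prod_emb Npos ?U J (Pi\<^sub>E J F)"
    have E: "?E \<in> sets nu" unfolding nu_def using J F by (intro sets_PiM_I) auto
    have "?t -` ?E \<inter> space nu
        = {\<omega> \<in> space (Pi\<^sub>M Npos ?U). \<forall>j\<in>J. \<omega> j \<in> {b \<in> G. G_add (a j) b \<in> F j}}"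
      using J a G_add_G
      by (auto simp: prod_emb_def nu_def space_PiM space_uniform_count_measure PiE_iff
          subset_eq Pi_iff extensional_def)
    then have "emeasure (distr nu nu ?t) ?E = emeasure (Pi\<^sub>M Npos ?U)
        {\<omega> \<in> space (Pi\<^sub>M Npos ?U). \<forall>j\<in>J. \<omega> j \<in> {b \<in> G. G_add (a j) b \<in> F j}}"
      unfolding emeasure_distr[OF meas E] by (simp only: nu_def)
    also have "\<dots> = (\<Prod>j\<in>J. emeasure (?U j) {b \<in> G. G_add (a j) b \<in> F j})"
      using J by (intro U.emeasure_PiM_Collect) (auto simp: sets_uniform_count_measure)
    also have "\<dots> = (\<Prod>j\<in>J. emeasure (?U j) (F j))"
    proof (rule prod.cong[OF refl])
      fix j assume j: "j \<in> J"
      have "finite G" by (simp add: G_def)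
      moreover have "a j \<in> G" using a j J by auto
      ultimately show "emeasure (?U j) {b \<in> G. G_add (a j) b \<in> F j} = emeasure (?U j) (F j)"
        using FG[OF j] by (simp add: emeasure_uniform_count_measure G_add_preimage_card)
    qed
    finally show "emeasure (distr nu nu ?t) ?E = (\<Prod>j\<in>J. emeasure (?U j) (F j))" .
  qed
  then show ?thesis by (simp add: nu_def)
qed

definition dilation :: "nat \<Rightarrow> (nat \<Rightarrow> int) \<Rightarrow> (nat \<Rightarrow> int)" where
  "dilation l \<omega> = (\<lambda>n\<in>Npos. \<omega> (l * n))"


section \<open>Measure-preserving maps\<close>

definition measure_preserving :: "'a measure \<Rightarrow> ('a \<Rightarrow> 'a) \<Rightarrow> bool" where
  "measure_preserving M T \<longleftrightarrow>
     T \<in> measurable M M \<and> (\<forall>A\<in>sets M. emeasure M (T -` A \<inter> space M) = emeasure M A)"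

text \<open>Invertibility in the category of measure-preserving maps, i.e. up to null sets. A genuine
  measurable inverse of a measure-preserving map is in particular an inverse in this sense.\<close>

definition invertible_mod_null :: "'a measure \<Rightarrow> ('a \<Rightarrow> 'a) \<Rightarrow> bool" where
  "invertible_mod_null M T \<longleftrightarrow> measure_preserving M T \<and>
     (\<exists>S. measure_preserving M S \<and> (AE x in M. S (T x) = x) \<and> (AE x in M. T (S x) = x))"

text \<open>For the next three notions \<open>M\<close> is meant to be a probability space.\<close>

definition exact_map :: "'a measure \<Rightarrow> ('a \<Rightarrow> 'a) \<Rightarrow> bool" where
  "exact_map M T \<longleftrightarrow> measure_preserving M T \<and>
     (\<forall>A \<in> (\<Inter>k\<in>{1..}. {(T ^^ k) -` B \<inter> space M | B. B \<in> sets M}).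
        measure M A = 0 \<or> measure M A = 1)"

definition strongly_mixing :: "'a measure \<Rightarrow> ('a \<Rightarrow> 'a) \<Rightarrow> bool" where
  "strongly_mixing M T \<longleftrightarrow> measure_preserving M T \<and>
     (\<forall>A\<in>sets M. \<forall>B\<in>sets M.
        (\<lambda>k. measure M (A \<inter> ((T ^^ k) -` B \<inter> space M))) \<longlonglongrightarrow> measure M A * measure M B)"

definition ergodic_map :: "'a measure \<Rightarrow> ('a \<Rightarrow> 'a) \<Rightarrow> bool" where
  "ergodic_map M T \<longleftrightarrow> measure_preserving M T \<and>
     (\<forall>A\<in>sets M. T -` A \<inter> space M = A \<longrightarrow> measure M A = 0 \<or> measure M A = 1)"

definition mult_semigroup_action ::
    "nat set \<Rightarrow> 'a measure \<Rightarrow> (nat \<Rightarrow> 'a \<Rightarrow> 'a) \<Rightarrow> bool" where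
  "mult_semigroup_action L M T \<longleftrightarrow>
     (\<forall>l\<in>L. measure_preserving M (T l)) \<and>
     (\<forall>l\<in>L. \<forall>m\<in>L. l * m \<in> L \<and> (\<forall>x\<in>space M. T l (T m x) = T (l * m) x))"

definition ergodic_action ::
    "nat set \<Rightarrow> 'a measure \<Rightarrow> (nat \<Rightarrow> 'a \<Rightarrow> 'a) \<Rightarrow> bool" where
  "ergodic_action L M T \<longleftrightarrow> mult_semigroup_action L M T \<and>
     (\<forall>A\<in>sets M. (\<forall>l\<in>L. T l -` A \<inter> space M = A) \<longrightarrow> measure M A = 0 \<or> measure M A = 1)"


section \<open>Kolmogorov--Sinai entropy\<close>

definition finite_measurable_partition :: "'a measure \<Rightarrow> 'a set set \<Rightarrow> bool" where
  "finite_measurable_partition M P \<longleftrightarrow> finite P \<and> P \<subseteq> sets M \<and> partition_on (space M) P"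

definition partition_entropy :: "'a measure \<Rightarrow> 'a set set \<Rightarrow> real" where
  "partition_entropy M P = - (\<Sum>A\<in>P. measure M A * ln (measure M A))"

definition partition_join :: "'a set set \<Rightarrow> 'a set set \<Rightarrow> 'a set set" where
  "partition_join P Q = {A \<inter> B | A B. A \<in> P \<and> B \<in> Q} - {{}}"

definition partition_preimage ::
    "'a measure \<Rightarrow> ('a \<Rightarrow> 'a) \<Rightarrow> 'a set set \<Rightarrow> 'a set set" where
  "partition_preimage M T P = {T -` A \<inter> space M | A. A \<in> P} - {{}}"

text \<open>\<open>iterated_join M T P n\<close> is the common refinement of $T^{-i}P$ for $0\le i<n$.\<close>

primrec iterated_join ::
    "'a measure \<Rightarrow> ('a \<Rightarrow> 'a) \<Rightarrow> 'a set set \<Rightarrow> nat \<Rightarrow> 'a set set" where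
  "iterated_join M T P 0 = {space M}"
| "iterated_join M T P (Suc n) =
     partition_join (iterated_join M T P n) (partition_preimage M (T ^^ n) P)"

text \<open>The limit exists in the reals, by subadditivity, whenever \<open>T\<close> preserves the probability
  measure \<open>M\<close> and \<open>P\<close> is a finite measurable partition.\<close>

definition entropy_wrt_partition ::
    "'a measure \<Rightarrow> ('a \<Rightarrow> 'a) \<Rightarrow> 'a set set \<Rightarrow> real" where
  "entropy_wrt_partition M T P = lim (\<lambda>n. partition_entropy M (iterated_join M T P n) / real n)"

definition ks_entropy :: "'a measure \<Rightarrow> ('a \<Rightarrow> 'a) \<Rightarrow> ereal" where
  "ks_entropy M T = (SUP P\<in>{P. finite_measurable_partition M P}. ereal (entropy_wrt_partition M T P))"

end

(* An event that depends on finitely many coordinates is independent of every event pulled back along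
   dilation n, once n exceeds all these coordinates. By a Dynkin argument, every event A satisfies
   nu (A Int T^-k B_k) - nu A * nu B_k --> 0 for T = dilation l and arbitrary events B_k. Constant B_k
   give mixing; if A = T^-k B_k for all k, the limit reads nu A = (nu A)^2, which is exactness.
   For the entropy, partition by the coordinates in a set D of m integers not divisible by l: the sets
   l^i * D are pairwise disjoint, so the join of the first n preimages has entropy n * m * ln 3. *)

theory Submission
  imports Defs
begin

interpretation nu: prob_space nu
  by (rule prob_space_nu)

interpretation coord: product_prob_space "\<lambda>n::nat. uniform_count_measure G" Npos
  by (intro product_prob_spaceI prob_space_G)


section \<open>Asymptotic independence\<close>

text \<open>The sets \<open>A\<close> whose defect from independence tends to 0 form a Dynkin
  system: a complement only changes the sign of the defect, and countable disjoint unions are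
  handled by dominated convergence. The events \<open>Y k\<close> may vary freely with
  \<open>k\<close>, which exactness requires.\<close>

lemma (in prob_space) asymptotic_indep_generator:
  assumes "Int_stable E" "E \<subseteq> Pow (space M)" "sets M = sigma_sets (space M) E"
    and Y [measurable]: "\<And>k. Y k \<in> events"
    and E: "\<And>A. A \<in> E \<Longrightarrow> (\<lambda>k. prob (A \<inter> Y k) - prob A * prob (Y k)) \<longlonglongrightarrow> 0"
    and A: "A \<in> events"
  shows "(\<lambda>k. prob (A \<inter> Y k) - prob A * prob (Y k)) \<longlonglongrightarrow> 0"
  using assms(1,2) A[unfolded assms(3)]
proof (induction rule: sigma_sets_induct_disjoint)
  case (basic A)
  then show ?case by (rule E)
next
  case empty
  then show ?case by simp
next
  case (compl A)
  then have A [measurable]: "A \<in> events" by (simp add: assms(3))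
  have "prob ((space M - A) \<inter> Y k) - prob (space M - A) * prob (Y k)
      = - (prob (A \<inter> Y k) - prob A * prob (Y k))" for k
  proof -
    have "(space M - A) \<inter> Y k = Y k - A \<inter> Y k"
      using sets.sets_into_space[OF Y] by blast
    then have "prob ((space M - A) \<inter> Y k) = prob (Y k) - prob (A \<inter> Y k)"
      by (simp add: finite_measure_Diff)
    then show ?thesis by (simp add: prob_compl algebra_simps)
  qed
  then show ?case using tendsto_minus[OF compl.IH] by simp
next
  case (union F)
  then have F [measurable]: "F i \<in> events" for i by (auto simp: assms(3))
  define a where "a i k = prob (F i \<inter> Y k) - prob (F i) * prob (Y k)" for i k
  have F_sums: "(\<lambda>i. prob (F i)) sums prob (\<Union>i. F i)"
    using union(1) by (intro finite_measure_UNION) auto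
  have "disjoint_family (\<lambda>i. F i \<inter> Y k)" for k
    using union(1) by (auto simp: disjoint_family_on_def)
  then have "(\<lambda>i. prob (F i \<inter> Y k)) sums prob (\<Union>i. F i \<inter> Y k)" for k
    by (intro finite_measure_UNION) auto
  then have a_sums: "(\<lambda>i. a i k) sums (prob ((\<Union>i. F i) \<inter> Y k) - prob (\<Union>i. F i) * prob (Y k))" for k
    unfolding a_def using F_sums by (auto intro!: sums_diff sums_mult2 simp: Int_UN_distrib2)
  \<comment> \<open>Both terms of the defect lie between 0 and \<open>prob (F i)\<close>. This bound
    does not depend on \<open>k\<close> and is summable by disjointness, so Tannery's theorem
    exchanges the limit in \<open>k\<close> with the sum over \<open>i\<close>.\<close>
  have "norm (a i k) \<le> prob (F i)" for i k
  proof -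
    have "prob (F i \<inter> Y k) \<le> prob (F i)" by (intro finite_measure_mono) auto
    moreover have "prob (F i) * prob (Y k) \<le> prob (F i)"
      by (simp add: mult_left_le)
    ultimately show ?thesis
      unfolding a_def real_norm_def abs_le_iff
      by (smt (verit) measure_nonneg mult_nonneg_nonneg)
  qed
  then have "(\<forall>\<^sub>F k in sequentially. summable (\<lambda>i. norm (a i k))) \<and> summable (\<lambda>i::nat. norm (0::real)) \<and>
      (\<lambda>k. \<Sum>i. a i k) \<longlonglongrightarrow> (\<Sum>i. 0)"
    using union.IH F_sums
    by (intro tannerys_theorem[where M = "\<lambda>i. prob (F i)"]) (auto simp: a_def sums_iff case_prod_unfold)
  then show ?case using a_sums by (simp add: sums_iff)
qed


section \<open>The dilations\<close>

text \<open>The map n -> l * n is injective on \<open>Npos\<close>, and reading an i.i.d. family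
  along an injective reindexing gives an i.i.d. family with the same law.\<close>

lemma distr_dilation:
  assumes "l \<ge> 1"
  shows "distr nu nu (dilation l) = nu"
  unfolding nu_def dilation_def
  using assms
  by (intro distr_PiM_reindex[where f = "\<lambda>n. l * n"] prob_space_G) (auto simp: inj_on_def Npos_def)

lemma measurable_dilation:
  assumes "l \<ge> 1"
  shows "dilation l \<in> measurable nu nu"
  unfolding nu_def dilation_def
  using assms by (intro measurable_restrict measurable_component_singleton) (auto simp: Npos_def)

lemma dilation_vimage_sets:
  assumes "l \<ge> 1" "B \<in> sets nu"
  shows "dilation l -` B \<inter> space nu \<in> sets nu"
  using measurable_dilation[OF assms(1)] assms(2) by (rule measurable_sets)

lemma emeasure_dilation_vimage:
  assumes "l \<ge> 1" "B \<in> sets nu"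
  shows "emeasure nu (dilation l -` B \<inter> space nu) = emeasure nu B"
  using emeasure_distr[OF measurable_dilation[OF assms(1)] assms(2)]
  by (simp only: distr_dilation[OF assms(1)])

lemma measure_preserving_dilation:
  assumes "l \<ge> 1"
  shows "measure_preserving nu (dilation l)"
  using assms by (auto simp: measure_preserving_def measurable_dilation emeasure_dilation_vimage)

lemma dilation_dilation:
  assumes "l \<ge> 1"
  shows "dilation l (dilation m \<omega>) = dilation (l * m) \<omega>"
  using assms by (auto simp: dilation_def Npos_def fun_eq_iff ac_simps)

lemma dilation_in_space: "l \<ge> 1 \<Longrightarrow> \<omega> \<in> space nu \<Longrightarrow> dilation l \<omega> \<in> space nu"
  using measurable_space[OF measurable_dilation] .

lemma funpow_dilation:
  assumes "l \<ge> 1" "\<omega> \<in> space nu"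
  shows "(dilation l ^^ k) \<omega> = dilation (l ^ k) \<omega>"
proof (induction k)
  \<comment> \<open>\<open>dilation 1\<close> sets the value at 0 to \<open>undefined\<close>, so it
    is the identity only on extensional functions; hence the restriction to points of
    \<open>space nu\<close>.\<close>
  case 0
  show ?case using assms(2) by (auto simp: dilation_def fun_eq_iff space_nu PiE_iff extensional_def)
next
  case (Suc k)
  then show ?case using assms(1) by (simp add: dilation_dilation)
qed

lemma funpow_dilation_vimage:
  assumes "l \<ge> 1"
  shows "(dilation l ^^ k) -` B \<inter> space nu = dilation (l ^ k) -` B \<inter> space nu"
  using assms by (auto simp: funpow_dilation)

section \<open>Independence of the coordinates and of events pulled back along a dilation\<close>

lemma indep_vars_coordinates:
  "nu.indep_vars (\<lambda>_. uniform_count_measure G) (\<lambda>n \<omega>. \<omega> n) Npos"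
proof -
  \<comment> \<open>Independence means that the joint law is the product of the marginals. The joint
    law is \<open>nu\<close> itself, since restricting to \<open>Npos\<close> fixes every point of
    \<open>space nu\<close>, and each marginal is uniform on \<open>G\<close>.\<close>
  have "distr nu (\<Pi>\<^sub>M n\<in>Npos. uniform_count_measure G) (\<lambda>\<omega>. \<lambda>n\<in>Npos. \<omega> n) = distr nu nu (\<lambda>\<omega>. \<omega>)"
    by (intro distr_cong) (auto simp: nu_def space_PiM PiE_iff extensional_def fun_eq_iff)
  also have "\<dots> = (\<Pi>\<^sub>M n\<in>Npos. distr nu (uniform_count_measure G) (\<lambda>\<omega>. \<omega> n))"
    unfolding distr_id unfolding nu_def by (intro PiM_cong refl coord.PiM_component[symmetric])
  finally show ?thesis
    by (subst nu.indep_vars_iff_distr_eq_PiM')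
       (auto simp: Npos_def nu_def intro!: measurable_component_singleton)
qed

text \<open>The pulled back event only depends on coordinates divisible by \<open>n\<close>, none of which lies in \<open>J\<close>.\<close>

lemma cylinder_indep_dilation:
  assumes J: "J \<subseteq> Npos" "\<And>j. j \<in> J \<Longrightarrow> j < n" and n: "n \<ge> 1"
    and C: "C \<in> sets (\<Pi>\<^sub>M j\<in>J. uniform_count_measure G)" and B: "B \<in> sets nu"
  defines "A \<equiv> {\<omega> \<in> space nu. restrict \<omega> J \<in> C}"
  shows "measure nu (A \<inter> (dilation n -` B \<inter> space nu)) = measure nu A * measure nu B"
proof -
  let ?K = "(\<lambda>i. n * i) ` Npos"
  let ?U = "\<lambda>_::nat. uniform_count_measure G"
  \<comment> \<open>Positive multiples of \<open>n\<close> are at least \<open>n\<close>, while all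
    elements of \<open>J\<close> are below \<open>n\<close>.\<close>
  have "J \<inter> ?K = {}" "?K \<subseteq> Npos"
    using J n by (fastforce simp: Npos_def)+
  then have indep: "nu.indep_var (PiM J ?U) (\<lambda>\<omega>. restrict \<omega> J) (PiM ?K ?U) (\<lambda>\<omega>. restrict \<omega> ?K)"
    using nu.indep_var_restrict[OF indep_vars_coordinates] J by blast
  have "dilation n \<in> measurable (PiM ?K ?U) nu"
    unfolding nu_def dilation_def by (intro measurable_restrict measurable_component_singleton) auto
  then have "nu.indep_var (PiM J ?U) (id \<circ> (\<lambda>\<omega>. restrict \<omega> J)) nu (dilation n \<circ> (\<lambda>\<omega>. restrict \<omega> ?K))"
    by (intro nu.indep_var_compose[OF indep]) auto
  moreover have "dilation n \<circ> (\<lambda>\<omega>. restrict \<omega> ?K) = dilation n"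
    by (auto simp: dilation_def fun_eq_iff)
  ultimately have "nu.indep_var (PiM J ?U) (\<lambda>\<omega>. restrict \<omega> J) nu (dilation n)" by simp
  from nu.indep_varD[OF this C B]
  have "measure nu ((\<lambda>\<omega>. (restrict \<omega> J, dilation n \<omega>)) -` (C \<times> B) \<inter> space nu)
      = measure nu A * measure nu (dilation n -` B \<inter> space nu)"
    by (simp add: A_def vimage_def Int_def conj_commute)
  also have "(\<lambda>\<omega>. (restrict \<omega> J, dilation n \<omega>)) -` (C \<times> B) \<inter> space nu
      = A \<inter> (dilation n -` B \<inter> space nu)"
    by (auto simp: A_def)
  finally show ?thesis
    using emeasure_dilation_vimage[OF n B] by (simp add: measure_def)
qed

text \<open>For a cylinder over finitely many coordinates the defect is exactly 0 as soon as
  \<open>n k\<close> exceeds them all; the Dynkin argument extends the limit to every event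
  \<open>A\<close>.\<close>

lemma asymptotic_indep_dilation:
  fixes n :: "nat \<Rightarrow> nat"
  assumes lim: "filterlim n at_top sequentially" and n: "\<And>k. n k \<ge> 1"
    and A: "A \<in> sets nu" and B: "\<And>k. B k \<in> sets nu"
  shows "(\<lambda>k. measure nu (A \<inter> (dilation (n k) -` B k \<inter> space nu)) - measure nu A * measure nu (B k))
           \<longlonglongrightarrow> 0"
proof -
  let ?U = "\<lambda>_::nat. uniform_count_measure G"
  let ?Y = "\<lambda>k. dilation (n k) -` B k \<inter> space nu"
  \<comment> \<open>Measure preservation allows \<open>B k\<close> to be replaced by its preimage
    \<open>?Y k\<close> in the product, the form in which the Dynkin argument is stated.\<close>
  have eq: "measure nu (?Y k) = measure nu (B k)" for k
    using emeasure_dilation_vimage[OF n B] by (simp add: measure_def)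
  have "(\<lambda>k. measure nu (A \<inter> ?Y k) - measure nu A * measure nu (?Y k)) \<longlonglongrightarrow> 0"
  proof (rule nu.asymptotic_indep_generator[OF _ _ _ _ _ A])
    show "Int_stable (prod_algebra Npos ?U)" by (rule Int_stable_prod_algebra)
    show "prod_algebra Npos ?U \<subseteq> Pow (space nu)"
      unfolding nu_def space_PiM by (rule prod_algebra_sets_into_space)
    show "sets nu = sigma_sets (space nu) (prod_algebra Npos ?U)"
      unfolding nu_def space_PiM by (rule sets_PiM)
    show "?Y k \<in> sets nu" for k by (rule dilation_vimage_sets[OF n B])
    fix A assume "A \<in> prod_algebra Npos ?U"
    then obtain J F where J: "A = prod_emb Npos ?U J (\<Pi>\<^sub>E j\<in>J. F j)" "finite J" "J \<subseteq> Npos"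
        "\<And>j. j \<in> J \<Longrightarrow> F j \<in> sets (uniform_count_measure G)"
      by (elim prod_algebraE) auto
    have A_eq: "A = {\<omega> \<in> space nu. restrict \<omega> J \<in> Pi\<^sub>E J F}"
      unfolding J(1) prod_emb_def nu_def space_PiM by auto
    have F: "Pi\<^sub>E J F \<in> sets (PiM J ?U)"
      using J by (intro sets_PiM_I_finite) auto
    obtain N where N: "\<And>j. j \<in> J \<Longrightarrow> j < N"
      using J(2) unfolding finite_nat_set_iff_bounded by (elim exE) blast
    have "\<forall>\<^sub>F k in sequentially. N \<le> n k"
      using lim by (simp add: filterlim_at_top)
    then have "\<forall>\<^sub>F k in sequentially. measure nu (A \<inter> ?Y k) - measure nu A * measure nu (?Y k) = 0"
    proof eventually_elim
      case (elim k)
      have "measure nu (A \<inter> ?Y k) = measure nu A * measure nu (B k)"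
        unfolding A_eq using elim N J by (intro cylinder_indep_dilation n B F) force+
      then show ?case by (simp add: eq)
    qed
    then show "(\<lambda>k. measure nu (A \<inter> ?Y k) - measure nu A * measure nu (?Y k)) \<longlonglongrightarrow> 0"
      by (rule tendsto_eventually)
  qed
  then show ?thesis by (simp only: eq)
qed

section \<open>Exactness, strong mixing and ergodicity of a single dilation\<close>

lemma filterlim_power_at_top_nat:
  fixes l :: nat
  assumes "l \<ge> 2"
  shows "filterlim (\<lambda>k. l ^ k) at_top sequentially"
  by (rule filterlim_at_top_mono[OF filterlim_ident])
     (use assms in \<open>auto intro!: always_eventually less_imp_le less_exp[THEN less_le_trans] power_mono\<close>)

lemma exact_dilation:
  assumes l: "l \<ge> 2"
  shows "exact_map nu (dilation l)"
  unfolding exact_map_def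
proof (intro conjI ballI)
  show "measure_preserving nu (dilation l)"
    using l by (intro measure_preserving_dilation) simp
  fix A assume A: "A \<in> (\<Inter>k\<in>{1..}. {(dilation l ^^ k) -` B \<inter> space nu | B. B \<in> sets nu})"
  have pow: "l ^ k \<ge> 1" for k using l by simp
  \<comment> \<open>The tail intersection starts at exponent 1, hence \<open>Suc k\<close>. The set
    \<open>B\<close> may be a different one for each \<open>k\<close>.\<close>
  have "\<exists>B. B \<in> sets nu \<and> A = dilation (l ^ Suc k) -` B \<inter> space nu" for k
    using INT_D[OF A, of "Suc k"] l by (auto simp: funpow_dilation_vimage simp del: funpow.simps power_Suc)
  then obtain B where B: "\<And>k. B k \<in> sets nu" "\<And>k. A = dilation (l ^ Suc k) -` B k \<inter> space nu"
    by metis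
  have sets: "A \<in> sets nu"
    using dilation_vimage_sets[OF pow B(1)] B(2) by metis
  have eq: "measure nu (B k) = measure nu A" for k
    using emeasure_dilation_vimage[OF pow B(1)] B(2) by (metis measure_def)
  have "(\<lambda>k. measure nu (A \<inter> (dilation (l ^ Suc k) -` B k \<inter> space nu)) - measure nu A * measure nu (B k))
      \<longlonglongrightarrow> 0"
    by (intro asymptotic_indep_dilation pow sets B(1)
        filterlim_compose[OF filterlim_power_at_top_nat[OF l] filterlim_Suc])
  \<comment> \<open>Every preimage equals \<open>A\<close> and every \<open>B k\<close> has the
    measure of \<open>A\<close>, so the sequence is constant and must be 0.\<close>
  then have "(\<lambda>k::nat. measure nu A - measure nu A * measure nu A) \<longlonglongrightarrow> 0"
    unfolding B(2)[symmetric] eq by simp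
  then have "measure nu A * (1 - measure nu A) = 0"
    by (simp add: LIMSEQ_const_iff algebra_simps)
  then show "measure nu A = 0 \<or> measure nu A = 1" by auto
qed

lemma strongly_mixing_dilation:
  assumes l: "l \<ge> 2"
  shows "strongly_mixing nu (dilation l)"
  unfolding strongly_mixing_def
proof (intro conjI ballI)
  show "measure_preserving nu (dilation l)"
    using l by (intro measure_preserving_dilation) simp
  fix A B assume "A \<in> sets nu" "B \<in> sets nu"
  then have "(\<lambda>k. measure nu (A \<inter> (dilation (l ^ k) -` B \<inter> space nu)) - measure nu A * measure nu B)
      \<longlonglongrightarrow> 0"
    using l by (intro asymptotic_indep_dilation filterlim_power_at_top_nat) auto
  then show "(\<lambda>k. measure nu (A \<inter> ((dilation l ^^ k) -` B \<inter> space nu))) \<longlonglongrightarrow> measure nu A * measure nu B"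
    using l by (subst (asm) LIM_zero_iff) (simp add: funpow_dilation_vimage)
qed

text \<open>A strictly invariant set is its own preimage under every iterate, so it is a tail event
  and exactness applies.\<close>

lemma ergodic_dilation:
  assumes l: "l \<ge> 2"
  shows "ergodic_map nu (dilation l)"
  unfolding ergodic_map_def
proof (intro conjI ballI impI)
  show "measure_preserving nu (dilation l)"
    using l by (intro measure_preserving_dilation) simp
  fix A assume A: "A \<in> sets nu" "dilation l -` A \<inter> space nu = A"
  have "(dilation l ^^ k) -` A \<inter> space nu = A" for k
  proof (induction k)
    case 0
    show ?case using sets.sets_into_space[OF A(1)] by auto
  next
    case (Suc k)
    have "(dilation l ^^ Suc k) -` A \<inter> space nu
        = dilation l -` ((dilation l ^^ k) -` A \<inter> space nu) \<inter> space nu"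
      using l by (auto simp: funpow_swap1 dilation_in_space)
    then show ?case by (simp only: Suc.IH A(2))
  qed
  then show "measure nu A = 0 \<or> measure nu A = 1"
    using exact_dilation[OF l] A(1) unfolding exact_map_def by blast
qed


section \<open>Noninvertibility\<close>

text \<open>Membership in singletons is the form in which the measurability and product formulas for
  cylinders apply.\<close>

lemma atom_eq: "{\<omega>' \<in> space nu. \<forall>d\<in>D. \<omega>' d = \<omega> d} = {\<omega>' \<in> space nu. \<forall>d\<in>D. \<omega>' d \<in> {\<omega> d}}"
  by simp

lemma measure_atom:
  assumes D: "finite D" "D \<subseteq> Npos" and \<omega>: "\<And>d. d \<in> D \<Longrightarrow> \<omega> d \<in> G"
  shows "{\<omega>' \<in> space nu. \<forall>d\<in>D. \<omega>' d = \<omega> d} \<in> sets nu" (is "?A \<in> _")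
    and "measure nu {\<omega>' \<in> space nu. \<forall>d\<in>D. \<omega>' d = \<omega> d} = (1 / 3) ^ card D"
proof -
  have "{\<omega>' \<in> space nu. \<omega>' d \<in> {\<omega> d}} \<in> sets nu" if "d \<in> D" for d
    unfolding nu_def using that D \<omega>
    by (intro sets_Collect_single'[where P = "\<lambda>y. y \<in> {\<omega> d}"])
       (auto simp: sets_uniform_count_measure space_uniform_count_measure)
  then show "?A \<in> sets nu"
    unfolding atom_eq using D(1) by (intro sets.sets_Collect_finite_All) auto
  have G: "finite G" "card G = 3" by (auto simp: G_def)
  have "emeasure nu ?A = (\<Prod>d\<in>D. emeasure (uniform_count_measure G) {\<omega> d})"
    unfolding atom_eq unfolding nu_def
    using D \<omega> by (intro coord.emeasure_PiM_Collect) (auto simp: sets_uniform_count_measure)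
  also have "\<dots> = (\<Prod>d\<in>D. ennreal (1 / 3))"
    using \<omega> G by (intro prod.cong refl) (auto simp: emeasure_uniform_count_measure)
  also have "\<dots> = ennreal ((1 / 3) ^ card D)"
    by (simp add: ennreal_power)
  finally show "measure nu ?A = (1 / 3) ^ card D"
    by (simp add: measure_def)
qed

text \<open>Since 1 is not a multiple of \<open>l\<close>, coordinate 1 is never read: two points
  that differ only there have the same image.\<close>

lemma not_bij_dilation:
  assumes l: "l \<ge> 2"
  shows "\<not> bij_betw (dilation l) (space nu) (space nu)"
proof
  define \<omega> where "\<omega> a = (\<lambda>n\<in>Npos. if n = 1 then a else 0)" for a :: int
  assume "bij_betw (dilation l) (space nu) (space nu)"
  then have inj: "inj_on (dilation l) (space nu)" by (rule bij_betw_imp_inj_on)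
  have "\<omega> 0 \<in> space nu" "\<omega> 1 \<in> space nu"
    by (auto simp: \<omega>_def space_nu G_def)
  moreover have "dilation l (\<omega> 0) = dilation l (\<omega> 1)"
    using l by (auto simp: \<omega>_def dilation_def fun_eq_iff Npos_def)
  ultimately have "\<omega> 0 = \<omega> 1" using inj by (auto dest: inj_onD)
  from fun_cong[OF this, of 1] show False by (simp add: \<omega>_def Npos_def)
qed

text \<open>If \<open>S\<close> inverted \<open>dilation l\<close> almost everywhere, the value at coordinate 1 would be a function of
  \<open>dilation l \<omega>\<close>, of which it is independent.\<close>

lemma not_invertible_dilation:
  assumes l: "l \<ge> 2"
  shows "\<not> invertible_mod_null nu (dilation l)"
proof
  assume "invertible_mod_null nu (dilation l)"
  then obtain S where S: "measure_preserving nu S" "AE \<omega> in nu. S (dilation l \<omega>) = \<omega>"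
    unfolding invertible_mod_null_def by blast
  define A where "A = {\<omega> \<in> space nu. \<forall>d\<in>{1}. \<omega> d = (\<lambda>_. 0) d}"
  have A: "A \<in> sets nu" "measure nu A = 1 / 3"
    unfolding A_def by (subst measure_atom; simp add: Npos_def G_def)+
  define B where "B = S -` A \<inter> space nu"
  have S_meas: "S \<in> measurable nu nu"
    using S(1) by (simp add: measure_preserving_def)
  have B: "B \<in> sets nu" unfolding B_def using S_meas A(1) by (rule measurable_sets)
  have B_eq: "measure nu B = 1 / 3"
    using S(1) A by (simp add: measure_preserving_def B_def measure_def)
  have "A = {\<omega> \<in> space nu. restrict \<omega> {1} \<in> (\<Pi>\<^sub>E j\<in>{1}. {0})}"
    by (auto simp: A_def dest: fun_cong[where x = 1])
  moreover have "(\<Pi>\<^sub>E j\<in>{1::nat}. {0::int}) \<in> sets (\<Pi>\<^sub>M j\<in>{1}. uniform_count_measure G)"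
    by (intro sets_PiM_I_finite) (auto simp: sets_uniform_count_measure G_def)
  ultimately have "measure nu (A \<inter> (dilation l -` B \<inter> space nu)) = measure nu A * measure nu B"
    using l B by (simp only:) (intro cylinder_indep_dilation, auto simp: Npos_def)
  \<comment> \<open>Almost surely \<open>S\<close> recovers \<omega> from its image, so pulling
    \<open>B\<close> back along \<open>dilation l\<close> returns \<open>A\<close> up to a null set.
    With the independence above this gives 1/3 = 1/9.\<close>
  moreover have "measure nu (A \<inter> (dilation l -` B \<inter> space nu)) = measure nu A"
  proof (rule nu.finite_measure_eq_AE)
    show "AE \<omega> in nu. (\<omega> \<in> A \<inter> (dilation l -` B \<inter> space nu)) = (\<omega> \<in> A)"
      using S(2) AE_space by eventually_elim (use l in \<open>auto simp: B_def dilation_in_space\<close>)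
    show "A \<inter> (dilation l -` B \<inter> space nu) \<in> sets nu"
      using A(1) B l by (intro sets.Int dilation_vimage_sets) auto
  qed (rule A(1))
  ultimately show False by (simp add: A(2) B_eq)
qed


section \<open>Entropy\<close>

text \<open>Cells are generated from points of \<open>space nu\<close>, so none is empty, in
  accordance with the removal of \<open>{}\<close> from joins and preimages of partitions. Points
  that agree on \<open>D\<close> give the same cell.\<close>

definition coord_partition :: "nat set \<Rightarrow> (nat \<Rightarrow> int) set set" where
  "coord_partition D = (\<lambda>\<omega>. {\<omega>' \<in> space nu. \<forall>d\<in>D. \<omega>' d = \<omega> d}) ` space nu"

lemma finite_measurable_partition_coord_partition:
  assumes D: "finite D" "D \<subseteq> Npos"
  shows "finite_measurable_partition nu (coord_partition D)"
  unfolding finite_measurable_partition_def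
proof (intro conjI)
  \<comment> \<open>A cell depends only on the restriction of its base point to \<open>D\<close>,
    which ranges over a finite set.\<close>
  have "coord_partition D \<subseteq> (\<lambda>f. {\<omega>' \<in> space nu. \<forall>d\<in>D. \<omega>' d = f d}) ` (D \<rightarrow>\<^sub>E G)"
  proof
    fix A assume "A \<in> coord_partition D"
    then obtain \<omega> where \<omega>: "\<omega> \<in> space nu" "A = {\<omega>' \<in> space nu. \<forall>d\<in>D. \<omega>' d = \<omega> d}"
      by (auto simp: coord_partition_def)
    then have "A = {\<omega>' \<in> space nu. \<forall>d\<in>D. \<omega>' d = restrict \<omega> D d}" "restrict \<omega> D \<in> D \<rightarrow>\<^sub>E G"
      using D(2) by (auto simp: space_nu)
    then show "A \<in> (\<lambda>f. {\<omega>' \<in> space nu. \<forall>d\<in>D. \<omega>' d = f d}) ` (D \<rightarrow>\<^sub>E G)" by blast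
  qed
  moreover have "finite (D \<rightarrow>\<^sub>E G)" using D(1) by (intro finite_PiE) (auto simp: G_def)
  ultimately show "finite (coord_partition D)" by (meson finite_imageI finite_subset)
  show "coord_partition D \<subseteq> sets nu"
    unfolding coord_partition_def using D by (intro image_subsetI measure_atom) (auto simp: space_nu)
  show "partition_on (space nu) (coord_partition D)"
    by (rule partition_onI) (fastforce simp: coord_partition_def disjnt_def)+
qed

text \<open>All cells have the same measure, so the logarithm is a constant factor and the remaining
  sum is the total mass 1. The cells never have to be counted.\<close>

lemma partition_entropy_coord_partition:
  assumes D: "finite D" "D \<subseteq> Npos"
  shows "partition_entropy nu (coord_partition D) = card D * ln 3"
proof -
  let ?P = "coord_partition D"
  note P = finite_measurable_partition_coord_partition[OF D, unfolded finite_measurable_partition_def]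
  have "(\<Sum>A\<in>?P. measure nu A) = measure nu (\<Union>A\<in>?P. A)"
    using P by (intro nu.finite_measure_finite_Union[symmetric])
      (auto simp: disjoint_family_on_def partition_on_def disjoint_def)
  also have "(\<Union>A\<in>?P. A) = space nu" using P by (simp add: partition_on_def)
  finally have total: "(\<Sum>A\<in>?P. measure nu A) = 1" by (simp add: nu.prob_space)
  have "measure nu A = (1 / 3) ^ card D" if A_in: "A \<in> ?P" for A
  proof -
    obtain \<omega> where \<omega>: "\<omega> \<in> space nu" and A: "A = {\<omega>' \<in> space nu. \<forall>d\<in>D. \<omega>' d = \<omega> d}"
      using A_in by (auto simp: coord_partition_def)
    show ?thesis
      unfolding A using D \<omega> by (intro measure_atom) (auto simp: space_nu)
  qed
  then have "ln (measure nu A) = - (card D * ln 3)" if "A \<in> ?P" for A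
    using that by (simp add: ln_realpow ln_div)
  then have "(\<Sum>A\<in>?P. measure nu A * ln (measure nu A)) = (\<Sum>A\<in>?P. measure nu A) * - (card D * ln 3)"
    unfolding sum_distrib_right by (intro sum.cong) simp_all
  then show ?thesis unfolding partition_entropy_def total by simp
qed

text \<open>Any point of a nonempty intersection of two cells can serve as base point for
  both.\<close>

lemma partition_join_coord_partition:
  "partition_join (coord_partition D) (coord_partition E) = coord_partition (D \<union> E)"
proof (intro subset_antisym subsetI)
  fix C assume "C \<in> partition_join (coord_partition D) (coord_partition E)"
  then obtain \<omega>1 \<omega>2 \<omega> where "C = {\<omega>' \<in> space nu. \<forall>d\<in>D. \<omega>' d = \<omega>1 d} \<inter> {\<omega>' \<in> space nu. \<forall>d\<in>E. \<omega>' d = \<omega>2 d}"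
      and \<omega>: "\<omega> \<in> C"
    unfolding partition_join_def coord_partition_def by auto
  then have "C = {\<omega>' \<in> space nu. \<forall>d\<in>D \<union> E. \<omega>' d = \<omega> d}" "\<omega> \<in> space nu"
    by auto
  then show "C \<in> coord_partition (D \<union> E)" by (auto simp: coord_partition_def)
next
  fix C assume "C \<in> coord_partition (D \<union> E)"
  then obtain \<omega> where \<omega>: "\<omega> \<in> space nu" "C = {\<omega>' \<in> space nu. \<forall>d\<in>D \<union> E. \<omega>' d = \<omega> d}"
    by (auto simp: coord_partition_def)
  have "C = {\<omega>' \<in> space nu. \<forall>d\<in>D. \<omega>' d = \<omega> d} \<inter> {\<omega>' \<in> space nu. \<forall>d\<in>E. \<omega>' d = \<omega> d}" "\<omega> \<in> C"
    using \<omega> by auto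
  with \<omega>(1) show "C \<in> partition_join (coord_partition D) (coord_partition E)"
    unfolding partition_join_def coord_partition_def by blast
qed

lemma partition_preimage_coord_partition:
  assumes l: "l \<ge> 1" and D: "D \<subseteq> Npos"
  shows "partition_preimage nu (dilation l) (coord_partition D) = coord_partition ((\<lambda>d. l * d) ` D)"
proof -
  have pre: "dilation l -` {\<omega>' \<in> space nu. \<forall>d\<in>D. \<omega>' d = dilation l \<omega> d} \<inter> space nu
      = {\<omega>' \<in> space nu. \<forall>d\<in>(\<lambda>d. l * d) ` D. \<omega>' d = \<omega> d}" for \<omega>
    using D dilation_in_space[OF l] by (auto simp: dilation_def subset_eq)
  show ?thesis
  proof (intro subset_antisym subsetI)
    fix C assume "C \<in> partition_preimage nu (dilation l) (coord_partition D)"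
    \<comment> \<open>The base point \<open>\<omega>0\<close> may lie outside the image of the
      dilation. As the preimage is nonempty, it contains some \<omega>, and
      \<open>dilation l \<omega>\<close> is a base point of the same cell.\<close>
    then obtain \<omega>0 \<omega> where C: "C = dilation l -` {\<omega>' \<in> space nu. \<forall>d\<in>D. \<omega>' d = \<omega>0 d} \<inter> space nu"
        and \<omega>: "\<omega> \<in> C"
      unfolding partition_preimage_def coord_partition_def by auto
    then have "C = dilation l -` {\<omega>' \<in> space nu. \<forall>d\<in>D. \<omega>' d = dilation l \<omega> d} \<inter> space nu"
      by auto
    moreover have "\<omega> \<in> space nu" using C \<omega> by auto
    ultimately show "C \<in> coord_partition ((\<lambda>d. l * d) ` D)"
      unfolding pre coord_partition_def by blast
  next
    fix C assume "C \<in> coord_partition ((\<lambda>d. l * d) ` D)"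
    then obtain \<omega> where \<omega>: "\<omega> \<in> space nu"
        and C: "C = {\<omega>' \<in> space nu. \<forall>d\<in>(\<lambda>d. l * d) ` D. \<omega>' d = \<omega> d}"
      unfolding coord_partition_def by blast
    from C have "\<omega> \<in> C" using \<omega> by simp
    with C[folded pre] dilation_in_space[OF l \<omega>]
    show "C \<in> partition_preimage nu (dilation l) (coord_partition D)"
      unfolding partition_preimage_def coord_partition_def by blast
  qed
qed

lemma iterated_join_coord_partition:
  assumes l: "l \<ge> 1" and D: "D \<subseteq> Npos"
  shows "iterated_join nu (dilation l) (coord_partition D) n
    = coord_partition (\<Union>i<n. (\<lambda>d. l ^ i * d) ` D)"
proof (induction n)
  case 0
  \<comment> \<open>With no coordinates fixed, every point generates the cell
    \<open>space nu\<close>; a point is needed for this cell to occur at all.\<close>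
  have "space nu \<noteq> {}" by (rule nu.not_empty)
  then show ?case by (auto simp: coord_partition_def)
next
  case (Suc n)
  have "partition_preimage nu (dilation l ^^ n) (coord_partition D)
      = partition_preimage nu (dilation (l ^ n)) (coord_partition D)"
    unfolding partition_preimage_def by (simp only: funpow_dilation_vimage[OF l])
  also have "\<dots> = coord_partition ((\<lambda>d. l ^ n * d) ` D)"
    using l D by (intro partition_preimage_coord_partition) auto
  finally show ?case
    by (simp add: Suc.IH partition_join_coord_partition lessThan_Suc Un_commute)
qed

section \<open>Entropy of coordinate partitions and its unbounded growth\<close>

lemma inj_on_power_mult_nondivisible:
  fixes l :: nat
  assumes l: "l \<ge> 2" and D: "\<And>d. d \<in> D \<Longrightarrow> \<not> l dvd d"
  shows "inj_on (\<lambda>(i, d). l ^ i * d) (UNIV \<times> D)"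
proof -
  \<comment> \<open>Cancelling the smaller power of \<open>l\<close> leaves d = l^(j-i) * e, which
    is divisible by \<open>l\<close> unless the exponents agree.\<close>
  have "i = j \<and> d = e" if eq: "l ^ i * d = l ^ j * e" and le: "i \<le> j" and ndvd: "\<not> l dvd d" for i j d e
  proof -
    obtain k where k: "j = i + k" using le le_Suc_ex by blast
    then have "d = l ^ k * e" using eq l by (simp add: power_add)
    with ndvd have "k = 0" by (cases k) auto
    with k \<open>d = l ^ k * e\<close> show ?thesis by simp
  qed
  then have "i = j \<and> d = e" if "l ^ i * d = l ^ j * e" "d \<in> D" "e \<in> D" for i j d e
    using that D by (cases i j rule: le_cases) metis+
  then show ?thesis by (auto intro!: inj_onI)
qed

lemma entropy_coord_partition:
  assumes l: "l \<ge> 2" and D: "finite D" "\<And>d. d \<in> D \<Longrightarrow> \<not> l dvd d"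
  shows "entropy_wrt_partition nu (dilation l) (coord_partition D) = card D * ln 3"
proof -
  \<comment> \<open>The index 0 is excluded because \<open>l\<close> divides it.\<close>
  have Npos: "D \<subseteq> Npos"
  proof
    fix d assume "d \<in> D"
    with D(2) show "d \<in> Npos" by (cases d) (auto simp: Npos_def)
  qed
  have H: "partition_entropy nu (iterated_join nu (dilation l) (coord_partition D) n)
      = real n * (card D * ln 3)" for n
  proof -
    have "(\<Union>i<n. (\<lambda>d. l ^ i * d) ` D) = (\<lambda>(i, d). l ^ i * d) ` ({..<n} \<times> D)" by auto
    then have "card (\<Union>i<n. (\<lambda>d. l ^ i * d) ` D) = card ({..<n} \<times> D)"
      using inj_on_power_mult_nondivisible[OF l, of D] D(2)
      by (auto intro!: card_image elim!: inj_on_subset)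
    moreover have "finite (\<Union>i<n. (\<lambda>d. l ^ i * d) ` D)" using D(1) by simp
    moreover have "(\<Union>i<n. (\<lambda>d. l ^ i * d) ` D) \<subseteq> Npos"
      using Npos l by (auto simp: Npos_def subset_eq Suc_le_eq)
    ultimately show ?thesis
      using l Npos by (simp add: iterated_join_coord_partition partition_entropy_coord_partition card_cartesian_product)
  qed
  have "(\<lambda>n. partition_entropy nu (iterated_join nu (dilation l) (coord_partition D) n) / real n)
      \<longlonglongrightarrow> card D * ln 3"
    \<comment> \<open>The quotient is constant from n = 1 on; at n = 0 it is 0 by the convention for
      division by zero.\<close>
    by (rule tendsto_eventually[OF eventually_sequentiallyI[of 1]]) (simp add: H)
  then show ?thesis unfolding entropy_wrt_partition_def by (rule limI)
qed

lemma ks_entropy_dilation: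
  assumes l: "l \<ge> 2"
  shows "ks_entropy nu (dilation l) = \<infinity>"
proof -
  have bound: "ereal (real m) \<le> ks_entropy nu (dilation l)" for m
  proof -
    \<comment> \<open>The first \<open>m\<close> positive integers congruent to 1 modulo
      \<open>l\<close>: as many indices as desired, none divisible by \<open>l\<close>.\<close>
    define D where "D = (\<lambda>j. l * j + 1) ` {..<m}"
    have "\<not> l dvd l * j + 1" for j
      using l by (subst dvd_add_right_iff) auto
    then have D: "finite D" "\<And>d. d \<in> D \<Longrightarrow> \<not> l dvd d" "D \<subseteq> Npos"
      by (auto simp: D_def Npos_def)
    have "card D = m"
      unfolding D_def using l by (subst card_image) (auto simp: inj_on_def)
    \<comment> \<open>From ln 3 >= 1 the entropy m * ln 3 is at least \<open>m\<close>, which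
      suffices for unboundedness.\<close>
    have "exp 1 \<le> (3::real)" by (rule exp_le)
    then have "1 \<le> ln (3::real)" by (subst ln_ge_iff) auto
    then have "ereal (real m) \<le> ereal (m * ln 3)" by (simp add: mult_le_cancel_left1)
    also have "\<dots> = ereal (entropy_wrt_partition nu (dilation l) (coord_partition D))"
      using entropy_coord_partition[OF l D(1,2)] \<open>card D = m\<close> by simp
    also have "\<dots> \<le> ks_entropy nu (dilation l)"
      unfolding ks_entropy_def
      using finite_measurable_partition_coord_partition[OF D(1,3)] by (intro SUP_upper) simp
    finally show ?thesis .
  qed
  show ?thesis
  proof (rule ereal_top)
    fix B :: real
    have "ereal B \<le> ereal (real (nat \<lceil>B\<rceil>))" by (simp add: of_nat_ceiling)
    then show "ereal B \<le> ks_entropy nu (dilation l)" using bound by (rule order_trans)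
  qed
qed

theorem proposition7p1:
  shows "(\<forall>l\<ge>2.
            measure_preserving nu (dilation l) \<and>
            \<not> bij_betw (dilation l) (space nu) (space nu) \<and>
            \<not> invertible_mod_null nu (dilation l) \<and>
            exact_map nu (dilation l) \<and>
            strongly_mixing nu (dilation l) \<and>
            ergodic_map nu (dilation l) \<and>
            ks_entropy nu (dilation l) = \<infinity>) \<and>
         ergodic_action Npos nu dilation"
proof (intro conjI allI impI)
  show "ergodic_action Npos nu dilation"
    unfolding ergodic_action_def mult_semigroup_action_def
  proof (intro conjI ballI impI)
    \<comment> \<open>A set invariant under the whole action is in particular invariant under
      \<open>dilation 2\<close>, which is already ergodic.\<close>
    fix A assume "A \<in> sets nu" "\<forall>l\<in>Npos. dilation l -` A \<inter> space nu = A"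
    then show "measure nu A = 0 \<or> measure nu A = 1"
      using ergodic_dilation[of 2] by (auto simp: ergodic_map_def Npos_def)
  qed (auto simp: Npos_def dilation_dilation measure_preserving_dilation Suc_le_eq)
qed (simp_all add: measure_preserving_dilation not_bij_dilation not_invertible_dilation exact_dilation
    strongly_mixing_dilation ergodic_dilation ks_entropy_dilation)

end
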